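(* Let $(X,\mathscr{A},\mu)$ be a probability measure space. Then the space $\mathcal{M}_\mu$ possesses the following properties: (1) $\mathcal{M}_\mu$ is a Čech-complete space; (2) $\mathcal{M}_\mu$ is a Baire space.
   Context: $\mathcal{M}$ is the ring of real-valued measurable functions on $(X,\mathscr{A},\mu)$, where two functions that are equal $\mu$-almost everywhere are identified. A sequence $\{f_n\}$ in $\mathcal{M}$ converges in measure to $f\in\mathcal{M}$ if for each $c>0$, $\lim_{n\to\infty}\mu(\{x\in X:|f_n(x)-f(x)|>c\})=0$. For $A\subseteq\mathcal{M}$, $\overline{A}$ is the set of all $f\in\mathcal{M}$ for which there is a sequence in $A$ converging to $f$ in measure. $\mathcal{M}_\mu$ denotes $\mathcal{M}$ with the topology of convergence in measure, i.e. the topology $\{\mathcal{M}\setminus A: A\subseteq\mathcal{M},\ A=\overline{A}\}$. A Tychonoff space is Čech-complete if it is a $G_\delta$ subset of its Stone–Čech compactification. A space is Baire if every countable intersection of dense open sets is dense. *)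

theory Defs
  imports "HOL-Probability.Probability"
begin

section \<open>Measurable functions modulo almost everywhere equality\<close>

definition ae_eq_rel :: "'a measure \<Rightarrow> (('a \<Rightarrow> real) \<times> ('a \<Rightarrow> real)) set" where
  "ae_eq_rel M =
     {(f, g). f \<in> borel_measurable M \<and> g \<in> borel_measurable M \<and> (AE x in M. f x = g x)}"

lemma equiv_ae_eq_rel: "equiv (borel_measurable M) (ae_eq_rel M)"
proof (rule equivI)
  show "ae_eq_rel M \<subseteq> borel_measurable M \<times> borel_measurable M"
    by (auto simp: ae_eq_rel_def)
  show "refl_on (borel_measurable M) (ae_eq_rel M)"
    by (auto simp: refl_on_def ae_eq_rel_def)
  show "sym (ae_eq_rel M)"
    by (auto simp: sym_def ae_eq_rel_def elim: eventually_mono)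
  show "trans (ae_eq_rel M)"
    by (auto simp: trans_def ae_eq_rel_def elim: eventually_elim2)
qed

text \<open>Values of the representatives outside \<open>space M\<close> are irrelevant: they are identified as well.\<close>

definition ae_classes :: "'a measure \<Rightarrow> ('a \<Rightarrow> real) set set" where
  "ae_classes M = borel_measurable M // ae_eq_rel M"


section \<open>Convergence in measure\<close>

definition fun_converges_in_measure ::
    "'a measure \<Rightarrow> (nat \<Rightarrow> 'a \<Rightarrow> real) \<Rightarrow> ('a \<Rightarrow> real) \<Rightarrow> bool" where
  "fun_converges_in_measure M f g \<longleftrightarrow>
     (\<forall>c>0. (\<lambda>n. emeasure M {x \<in> space M. \<bar>f n x - g x\<bar> > c}) \<longlonglongrightarrow> 0)"

definition converges_in_measure ::
    "'a measure \<Rightarrow> (nat \<Rightarrow> ('a \<Rightarrow> real) set) \<Rightarrow> ('a \<Rightarrow> real) set \<Rightarrow> bool" where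
  "converges_in_measure M F G \<longleftrightarrow>
     (\<exists>f g. (\<forall>n. f n \<in> F n) \<and> g \<in> G \<and> fun_converges_in_measure M f g)"

lemma ae_classes_rep:
  assumes "F \<in> ae_classes M"
  shows "\<exists>f. f \<in> F" and "\<And>f. f \<in> F \<Longrightarrow> f \<in> borel_measurable M"
    and "\<And>f g. f \<in> F \<Longrightarrow> g \<in> F \<Longrightarrow> AE x in M. f x = g x"
proof -
  show "\<exists>f. f \<in> F"
    using assms equiv_ae_eq_rel in_quotient_imp_non_empty unfolding ae_classes_def by fastforce
  show "\<And>f. f \<in> F \<Longrightarrow> f \<in> borel_measurable M"
    using assms equiv_ae_eq_rel in_quotient_imp_subset unfolding ae_classes_def by fastforce
  show "\<And>f g. f \<in> F \<Longrightarrow> g \<in> F \<Longrightarrow> AE x in M. f x = g x"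
    using quotient_eqI[OF equiv_ae_eq_rel] assms in_quotient_imp_in_rel[OF equiv_ae_eq_rel, of F M]
    unfolding ae_classes_def ae_eq_rel_def by auto
qed

text \<open>The choice of representatives does not matter.\<close>

lemma converges_in_measure_iff_all_reps:
  assumes F: "\<And>n. F n \<in> ae_classes M" and G: "G \<in> ae_classes M"
  shows "converges_in_measure M F G \<longleftrightarrow>
     (\<forall>f g. (\<forall>n. f n \<in> F n) \<longrightarrow> g \<in> G \<longrightarrow> fun_converges_in_measure M f g)"
proof
  assume "converges_in_measure M F G"
  then obtain f g where fg: "\<And>n. f n \<in> F n" "g \<in> G" "fun_converges_in_measure M f g"
    unfolding converges_in_measure_def by blast
  show "\<forall>f g. (\<forall>n. f n \<in> F n) \<longrightarrow> g \<in> G \<longrightarrow> fun_converges_in_measure M f g"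
  proof (intro allI impI)
    fix f' g' assume f': "\<forall>n. f' n \<in> F n" and g': "g' \<in> G"
    have "emeasure M {x \<in> space M. \<bar>f' n x - g' x\<bar> > c} = emeasure M {x \<in> space M. \<bar>f n x - g x\<bar> > c}"
      for n and c :: real
    proof (rule emeasure_eq_AE)
      have [measurable]: "f n \<in> borel_measurable M" "f' n \<in> borel_measurable M"
        "g \<in> borel_measurable M" "g' \<in> borel_measurable M"
        using ae_classes_rep(2) F G fg f' g' by blast+
      show "{x \<in> space M. \<bar>f' n x - g' x\<bar> > c} \<in> sets M" by measurable
      show "{x \<in> space M. \<bar>f n x - g x\<bar> > c} \<in> sets M" by measurable
      have "AE x in M. f n x = f' n x" "AE x in M. g x = g' x"
        using ae_classes_rep(3) F G fg f' g' by blast+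
      then show "AE x in M. (x \<in> {x \<in> space M. \<bar>f' n x - g' x\<bar> > c}) =
                            (x \<in> {x \<in> space M. \<bar>f n x - g x\<bar> > c})"
        by eventually_elim auto
    qed
    then show "fun_converges_in_measure M f' g'"
      using fg(3) unfolding fun_converges_in_measure_def by simp
  qed
next
  assume *: "\<forall>f g. (\<forall>n. f n \<in> F n) \<longrightarrow> g \<in> G \<longrightarrow> fun_converges_in_measure M f g"
  obtain f where "\<And>n. f n \<in> F n"
    using ae_classes_rep(1)[OF F] by metis
  then show "converges_in_measure M F G"
    using * ae_classes_rep(1)[OF G] unfolding converges_in_measure_def by blast
qed


section \<open>The topology of convergence in measure\<close>

definition measure_closure :: "'a measure \<Rightarrow> ('a \<Rightarrow> real) set set \<Rightarrow> ('a \<Rightarrow> real) set set" where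
  "measure_closure M A =
     {G \<in> ae_classes M. \<exists>F. (\<forall>n::nat. F n \<in> A) \<and> converges_in_measure M F G}"

definition measure_topology :: "'a measure \<Rightarrow> ('a \<Rightarrow> real) set topology" where
  "measure_topology M =
     topology (\<lambda>U. \<exists>A \<subseteq> ae_classes M. A = measure_closure M A \<and> U = ae_classes M - A)"

lemma measure_closure_mono: "A \<subseteq> B \<Longrightarrow> measure_closure M A \<subseteq> measure_closure M B"
  unfolding measure_closure_def by blast

lemma measure_closure_superset:
  assumes "A \<subseteq> ae_classes M" shows "A \<subseteq> measure_closure M A"
proof
  fix G assume "G \<in> A"
  moreover from this assms have "G \<in> ae_classes M" by blast
  moreover from this obtain g where "g \<in> G" using ae_classes_rep(1) by blast
  then have "converges_in_measure M (\<lambda>_. G) G"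
    unfolding converges_in_measure_def fun_converges_in_measure_def
    by (intro exI[of _ "\<lambda>_. g"] exI[of _ g]) auto
  ultimately show "G \<in> measure_closure M A"
    unfolding measure_closure_def by (intro CollectI conjI exI[of _ "\<lambda>_. G"]) auto
qed

lemma converges_in_measure_subseq:
  assumes "converges_in_measure M F G" "strict_mono r"
  shows "converges_in_measure M (\<lambda>n. F (r n)) G"
proof -
  obtain f g where fg: "\<And>n. f n \<in> F n" "g \<in> G" "fun_converges_in_measure M f g"
    using assms(1) unfolding converges_in_measure_def by blast
  have "fun_converges_in_measure M (\<lambda>n. f (r n)) g"
    using fg(3) LIMSEQ_subseq_LIMSEQ[OF _ assms(2)]
    unfolding fun_converges_in_measure_def o_def by blast
  then show ?thesis
    unfolding converges_in_measure_def using fg by (intro exI[of _ "\<lambda>n. f (r n)"] exI[of _ g]) auto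
qed

lemma measure_closure_Un:
  "measure_closure M (A \<union> B) \<subseteq> measure_closure M A \<union> measure_closure M B"
proof
  fix G assume "G \<in> measure_closure M (A \<union> B)"
  then obtain F where G: "G \<in> ae_classes M" and F: "\<And>n. F n \<in> A \<union> B" "converges_in_measure M F G"
    unfolding measure_closure_def by blast
  have "infinite {n. F n \<in> A} \<or> infinite {n. F n \<in> B}"
  proof (rule ccontr)
    assume "\<not> ?thesis"
    then have "finite ({n. F n \<in> A} \<union> {n. F n \<in> B})" by blast
    moreover have "{n. F n \<in> A} \<union> {n. F n \<in> B} = UNIV" using F(1) by blast
    ultimately show False by simp
  qed
  moreover have "G \<in> measure_closure M C" if inf: "infinite {n. F n \<in> C}" for C
  proof -
    obtain r :: "nat \<Rightarrow> nat" where r: "strict_mono r" "\<And>n. F (r n) \<in> C"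
      using infinite_enumerate[OF inf] by auto
    then show ?thesis
      unfolding measure_closure_def using G converges_in_measure_subseq[OF F(2) r(1)]
      by (intro CollectI conjI exI[of _ "\<lambda>n. F (r n)"]) auto
  qed
  ultimately show "G \<in> measure_closure M A \<union> measure_closure M B" by blast
qed

lemma openin_measure_topology:
  "openin (measure_topology M) U \<longleftrightarrow>
     (\<exists>A \<subseteq> ae_classes M. A = measure_closure M A \<and> U = ae_classes M - A)"
proof -
  define P where
    "P = (\<lambda>U. \<exists>A \<subseteq> ae_classes M. A = measure_closure M A \<and> U = ae_classes M - A)"
  have PI: "P U" if "U \<subseteq> ae_classes M" "measure_closure M (ae_classes M - U) \<inter> U = {}" for U
  proof -
    have "measure_closure M (ae_classes M - U) \<subseteq> ae_classes M"
      unfolding measure_closure_def by blast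
    then have "measure_closure M (ae_classes M - U) \<subseteq> ae_classes M - U"
      using that(2) by blast
    then have "ae_classes M - U = measure_closure M (ae_classes M - U)"
      by (intro equalityI measure_closure_superset) auto
    moreover have "U = ae_classes M - (ae_classes M - U)" using that(1) by blast
    ultimately show ?thesis
      unfolding P_def by (metis Diff_subset)
  qed
  have PD: "U \<subseteq> ae_classes M" "measure_closure M (ae_classes M - U) \<inter> U = {}" if U: "P U" for U
  proof -
    obtain A where A: "A \<subseteq> ae_classes M" "A = measure_closure M A" "U = ae_classes M - A"
      using U unfolding P_def by auto
    show "U \<subseteq> ae_classes M" using A(3) by blast
    have "ae_classes M - U = A" using A(1,3) by blast
    then have "measure_closure M (ae_classes M - U) = A" using A(2) by simp
    then show "measure_closure M (ae_classes M - U) \<inter> U = {}" using A(3) by blast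
  qed
  have "istopology P"
    unfolding istopology_def
  proof (intro conjI allI impI)
    fix S T assume S: "P S" and T: "P T"
    have "ae_classes M - S \<inter> T = (ae_classes M - S) \<union> (ae_classes M - T)" by blast
    then have "measure_closure M (ae_classes M - S \<inter> T)
        \<subseteq> measure_closure M (ae_classes M - S) \<union> measure_closure M (ae_classes M - T)"
      using measure_closure_Un[of M "ae_classes M - S" "ae_classes M - T"] by simp
    then have "measure_closure M (ae_classes M - S \<inter> T) \<inter> (S \<inter> T) = {}"
      using PD(2)[OF S] PD(2)[OF T] by blast
    moreover have "S \<inter> T \<subseteq> ae_classes M" using PD(1)[OF S] by blast
    ultimately show "P (S \<inter> T)" by (intro PI)
  next
    fix K assume K: "\<forall>S\<in>K. P S"
    have "measure_closure M (ae_classes M - \<Union>K) \<inter> S = {}" if "S \<in> K" for S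
    proof -
      have "measure_closure M (ae_classes M - \<Union>K) \<subseteq> measure_closure M (ae_classes M - S)"
        using that by (intro measure_closure_mono) blast
      moreover have "measure_closure M (ae_classes M - S) \<inter> S = {}"
        using PD(2) K that by simp
      ultimately show ?thesis by blast
    qed
    then have "measure_closure M (ae_classes M - \<Union>K) \<inter> \<Union>K = {}" by blast
    moreover have "\<Union>K \<subseteq> ae_classes M" using PD(1) K by (intro Union_least) simp
    ultimately show "P (\<Union>K)" by (intro PI)
  qed
  then show ?thesis
    unfolding measure_topology_def P_def by (simp add: topology_inverse')
qed

lemma topspace_measure_topology: "topspace (measure_topology M) = ae_classes M"
proof
  show "topspace (measure_topology M) \<subseteq> ae_classes M"
    using openin_topspace[of "measure_topology M"] unfolding openin_measure_topology by (elim exE conjE) simp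
  have "openin (measure_topology M) (ae_classes M)"
    unfolding openin_measure_topology by (intro exI[of _ "{}"]) (auto simp: measure_closure_def)
  then show "ae_classes M \<subseteq> topspace (measure_topology M)"
    by (rule openin_subset)
qed


section \<open>Stone-Cech compactification and topological properties\<close>

definition tychonoff_space :: "'a topology \<Rightarrow> bool" where
  "tychonoff_space X \<longleftrightarrow> completely_regular_space X \<and> Hausdorff_space X"

text \<open>The Stone-Cech compactification is realised as the closure of the image of the
  evaluation map in the cube indexed by all continuous functions into the unit interval.
  Restricting the index set to \<open>extensional\<close> functions selects one HOL function for each such
  function on the carrier.\<close>

definition unit_interval_maps :: "'a topology \<Rightarrow> ('a \<Rightarrow> real) set" where
  "unit_interval_maps X =
     {f \<in> extensional (topspace X). continuous_map X (top_of_set {0..1}) f}"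

definition stone_cech_cube :: "'a topology \<Rightarrow> (('a \<Rightarrow> real) \<Rightarrow> real) topology" where
  "stone_cech_cube X = product_topology (\<lambda>_. top_of_set {0..1}) (unit_interval_maps X)"

definition stone_cech_map :: "'a topology \<Rightarrow> 'a \<Rightarrow> ('a \<Rightarrow> real) \<Rightarrow> real" where
  "stone_cech_map X x = (\<lambda>f\<in>unit_interval_maps X. f x)"

definition stone_cech :: "'a topology \<Rightarrow> (('a \<Rightarrow> real) \<Rightarrow> real) topology" where
  "stone_cech X =
     subtopology (stone_cech_cube X) (stone_cech_cube X closure_of (stone_cech_map X ` topspace X))"

definition cech_complete_space :: "'a topology \<Rightarrow> bool" where
  "cech_complete_space X \<longleftrightarrow>
     tychonoff_space X \<and> gdelta_in (stone_cech X) (stone_cech_map X ` topspace X)"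

definition baire_space :: "'a topology \<Rightarrow> bool" where
  "baire_space X \<longleftrightarrow>
     (\<forall>U::nat \<Rightarrow> 'a set.
        (\<forall>n. openin X (U n) \<and> X closure_of (U n) = topspace X) \<longrightarrow>
        X closure_of (\<Inter>n. U n) = topspace X)"

text \<open>The defining properties of the compactification: it is compact Hausdorff, contains the
  Tychonoff space \<open>X\<close> as a dense subspace, and every continuous map from \<open>X\<close> into the unit
  interval extends to it.\<close>

lemma compact_Hausdorff_stone_cech:
  "compact_space (stone_cech X)" "Hausdorff_space (stone_cech X)"
proof -
  have "compact_space (stone_cech_cube X)"
    unfolding stone_cech_cube_def
    by (simp add: compact_space_product_topology compact_space_subtopology)
  then show "compact_space (stone_cech X)"
    unfolding stone_cech_def
    by (simp add: closedin_compact_space compact_space_subtopology)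
  have "Hausdorff_space (stone_cech_cube X)"
    unfolding stone_cech_cube_def
    by (simp add: Hausdorff_space_product_topology Hausdorff_space_subtopology)
  then show "Hausdorff_space (stone_cech X)"
    unfolding stone_cech_def by (simp add: Hausdorff_space_subtopology)
qed

lemma stone_cech_map_in_cube:
  "stone_cech_map X ` topspace X \<subseteq> topspace (stone_cech_cube X)"
proof (rule image_subsetI)
  fix x assume x: "x \<in> topspace X"
  have "f x \<in> {0..1}" if "f \<in> unit_interval_maps X" for f
    using that x continuous_map_funspace[of X "top_of_set {0..1}" f]
    unfolding unit_interval_maps_def by (simp add: Pi_iff)
  then show "stone_cech_map X x \<in> topspace (stone_cech_cube X)"
    unfolding stone_cech_map_def stone_cech_cube_def
    by (simp only: topspace_product_topology topspace_euclidean_subtopology o_def) (rule restrict_PiE_iff[THEN iffD2], blast)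
qed

lemma dense_stone_cech_map:
  "stone_cech X closure_of (stone_cech_map X ` topspace X) = topspace (stone_cech X)"
proof -
  have "stone_cech_map X ` topspace X
      \<subseteq> stone_cech_cube X closure_of (stone_cech_map X ` topspace X)"
    by (rule closure_of_subset[OF stone_cech_map_in_cube])
  then show ?thesis
    unfolding stone_cech_def
    by (simp add: closure_of_subtopology Int_absorb1 Int_absorb2 closure_of_subset_topspace)
qed

lemma embedding_stone_cech_map:
  assumes "tychonoff_space X"
  shows "embedding_map X (stone_cech X) (stone_cech_map X)"
proof -
  have eq: "mspace (submetric (cfunspace X euclidean_metric) {f. f \<in> topspace X \<rightarrow> {0..1}})
      = unit_interval_maps X"
    unfolding unit_interval_maps_def
  proof (intro set_eqI iffI)
    fix f :: "'a \<Rightarrow> real" assume "f \<in> mspace (submetric (cfunspace X euclidean_metric) {f. f \<in> topspace X \<rightarrow> {0..1}})"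
    then have "f \<in> extensional (topspace X)" "continuous_map X euclideanreal f"
        "f \<in> topspace X \<rightarrow> {0..1}"
      by simp_all
    then show "f \<in> {f \<in> extensional (topspace X). continuous_map X (top_of_set {0..1}) f}"
      by (simp add: continuous_map_in_subtopology image_subset_iff_funcset)
  next
    fix f :: "'a \<Rightarrow> real" assume f: "f \<in> {f \<in> extensional (topspace X). continuous_map X (top_of_set {0..1::real}) f}"
    then have "f ` topspace X \<subseteq> {0..1}"
      by (auto simp: continuous_map_in_subtopology)
    then have "bounded (f ` topspace X)"
      using bounded_subset bounded_closed_interval by blast
    then show "f \<in> mspace (submetric (cfunspace X euclidean_metric) {f. f \<in> topspace X \<rightarrow> {0..1}})"
      using f by (auto simp: continuous_map_in_subtopology)
  qed
  have "embedding_map X (stone_cech_cube X) (stone_cech_map X)"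
    using completely_regular_space_cube_embedding_explicit[of X] assms
    unfolding tychonoff_space_def eq stone_cech_cube_def stone_cech_map_def by blast
  then show ?thesis
    unfolding stone_cech_def
    using closure_of_subset[OF stone_cech_map_in_cube] by (simp add: embedding_map_in_subtopology)
qed

lemma stone_cech_extension:
  assumes "continuous_map X (top_of_set {0..1::real}) f"
  shows "\<exists>g. continuous_map (stone_cech X) (top_of_set {0..1}) g \<and>
             (\<forall>x\<in>topspace X. g (stone_cech_map X x) = f x)"
proof -
  let ?f = "restrict f (topspace X)"
  have mem: "?f \<in> unit_interval_maps X"
    unfolding unit_interval_maps_def using assms continuous_map_eq[of X _ f ?f] by auto
  then have "continuous_map (stone_cech X) (top_of_set {0..1}) (\<lambda>p. p ?f)"
    unfolding stone_cech_def stone_cech_cube_def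
    by (intro continuous_map_from_subtopology)
       (use continuous_map_product_projection[of ?f "unit_interval_maps X" "\<lambda>_. top_of_set {0..1}"]
         in simp)
  then show ?thesis
    using mem by (intro exI[of _ "\<lambda>p. p ?f"]) (auto simp: stone_cech_map_def)
qed

end

theory Submission
  imports Defs
begin

text \<open>Convergence in measure is induced by the metric \<open>\<integral> min 1 \<bar>f - g\<bar>\<close> on classes, and this metric is
  complete: a fast Cauchy sequence has almost everywhere absolutely summable increments, hence
  converges almost everywhere. So \<open>M\<^sub>\<mu>\<close> is completely metrizable. Baire's theorem applies, and a
  completely metrizable dense subspace \<open>S\<close> of a Hausdorff space is a \<open>G\<^sub>\<delta>\<close>, namely the
  intersection over \<open>n\<close> of the unions of all open sets whose trace on \<open>S\<close> has diameter at most
  \<open>1/(n+1)\<close>.\<close>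

section \<open>Completely metrizable spaces\<close>

text \<open>A point \<open>p\<close> lying in every \<open>\<Union>(W n)\<close> has, by density,
  points of \<open>M\<close> in the finite intersections of its small neighbourhoods. These points
  form a Cauchy sequence, so completeness gives a limit in \<open>M\<close>, and the Hausdorff
  property identifies that limit with \<open>p\<close>.\<close>

lemma (in Metric_space) dense_mcomplete_imp_gdelta_in:
  assumes K: "Hausdorff_space K" and dense: "K closure_of M = topspace K"
    and sub: "M \<subseteq> topspace K" and top: "subtopology K M = mtopology" and compl: mcomplete
  shows "gdelta_in K M"
proof -
  define W where
    "W n = {A. openin K A \<and> (\<forall>x\<in>A \<inter> M. \<forall>y\<in>A \<inter> M. d x y < inverse (Suc n))}" for n
  have opn: "openin K (\<Union>(W n))" for n
    unfolding W_def by (intro openin_Union) auto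
  have "M \<subseteq> \<Union>(W n)" for n
  proof
    fix x assume x: "x \<in> M"
    have "openin (subtopology K M) (mball x (inverse (Suc n) / 2))"
      unfolding top by (rule openin_mball)
    then obtain A where A: "openin K A" "mball x (inverse (Suc n) / 2) = A \<inter> M"
      unfolding openin_subtopology by blast
    \<comment> \<open>Half the radius suffices: the triangle inequality through the centre
      \<open>x\<close> doubles it.\<close>
    have "d y z < inverse (Suc n)" if "y \<in> A \<inter> M" "z \<in> A \<inter> M" for y z
      using that triangle[of y x z] commute[of y x] unfolding A(2)[symmetric] by auto
    then have "A \<in> W n" unfolding W_def using A(1) by blast
    moreover have "x \<in> A" using A(2) x by (metis IntD1 centre_in_mball_iff half_gt_zero
          inverse_positive_iff_positive of_nat_0_less_iff zero_less_Suc)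
    ultimately show "x \<in> \<Union>(W n)" by blast
  qed
  then have "M \<subseteq> (\<Inter>n. \<Union>(W n))" by (rule INT_greatest)
  moreover have "(\<Inter>n. \<Union>(W n)) \<subseteq> M"
  proof
    fix p assume p: "p \<in> (\<Inter>n. \<Union>(W n))"
    have "\<forall>n. \<exists>A. A \<in> W n \<and> p \<in> A" using p by blast
    then obtain A where A: "\<And>n. A n \<in> W n" "\<And>n. p \<in> A n"
      by metis
    have opA: "openin K (A n)" for n using A(1) unfolding W_def by blast
    \<comment> \<open>Finite intersections stay open, so \<open>x n\<close> can be chosen in all of
      \<open>A 0\<close>, ..., \<open>A n\<close> at once. From index \<open>N\<close> on, the whole
      sequence then lies in \<open>A N\<close>, whose trace on \<open>M\<close> is small.\<close>
    have opI: "openin K (\<Inter>i\<le>n. A i)" for n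
      using opA by (intro openin_Inter) auto
    have meets: "\<exists>x. x \<in> M \<and> x \<in> B" if "openin K B" "p \<in> B" for B
      using dense that unfolding dense_intersects_open by blast
    have "\<exists>x. x \<in> M \<and> x \<in> (\<Inter>i\<le>n. A i)" for n
      using meets[OF opI] A(2) by blast
    then obtain x where x: "\<And>n. x n \<in> M" "\<And>n i. i \<le> n \<Longrightarrow> x n \<in> A i"
      by (metis INT_E atMost_iff)
    have diam: "d y z < inverse (Suc n)" if "y \<in> A n" "z \<in> A n" "y \<in> M" "z \<in> M" for y z n
      using A(1)[of n] that unfolding W_def by blast
    have "MCauchy x"
      unfolding MCauchy_def
    proof (intro conjI allI impI)
      show "range x \<subseteq> M" using x by blast
      fix e :: real assume "e > 0"
      then obtain N where "inverse (Suc N) < e" using reals_Archimedean by blast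
      then show "\<exists>N. \<forall>n n'. N \<le> n \<longrightarrow> N \<le> n' \<longrightarrow> d (x n) (x n') < e"
        using diam x by (meson order_less_trans)
    qed
    then obtain l where l: "limitin mtopology x l sequentially"
      using compl unfolding mcomplete_def by blast
    have lM: "l \<in> M" using l limitin_mspace by blast
    have "l = p"
    proof (rule ccontr)
      assume "l \<noteq> p"
      moreover have "p \<in> topspace K" using A(2)[of 0] opA[of 0] openin_subset by blast
      ultimately obtain B C where BC: "openin K B" "openin K C" "l \<in> B" "p \<in> C" "disjnt B C"
        using K lM sub unfolding Hausdorff_space_def by (metis subsetD)
      have "openin mtopology (B \<inter> M)"
        unfolding top[symmetric] using BC(1) by (auto simp: openin_subtopology)
      then obtain r where r: "r > 0" "mball l r \<subseteq> B"
        unfolding openin_mtopology using BC(3) lM by blast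
      \<comment> \<open>\<open>N1\<close> makes the trace of \<open>A N1\<close> smaller than
        \<open>r / 2\<close>, and \<open>N2\<close> brings the tail of \<open>x\<close> within
        \<open>r / 2\<close> of \<open>l\<close>.\<close>
      obtain N1 where N1: "inverse (Suc N1) < r / 2" using reals_Archimedean r(1) half_gt_zero by blast
      obtain N2 where N2: "\<And>n. n \<ge> N2 \<Longrightarrow> d (x n) l < r / 2"
        using l r(1) unfolding limit_metric_sequentially by (meson half_gt_zero)
      define n where "n = max N1 N2"
      \<comment> \<open>\<open>C \<inter> A N1\<close> is a neighbourhood of \<open>p\<close>, so it
        meets \<open>M\<close>. Both \<open>y\<close> and \<open>x n\<close> lie in
        \<open>A N1\<close>, hence \<open>y\<close> is within \<open>r\<close> of \<open>l\<close>
        and falls into \<open>B\<close>, although \<open>y \<in> C\<close>.\<close>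
      obtain y where y: "y \<in> M" "y \<in> C \<inter> A N1"
        using meets[of "C \<inter> A N1"] BC A(2) opA by blast
      have "d y (x n) < r / 2"
        using diam[of y N1 "x n"] y x N1 unfolding n_def by fastforce
      then have "d y l < r"
        using N2[of n] triangle[of y "x n" l] y(1) x(1) lM unfolding n_def by fastforce
      then have "y \<in> B" using r(2) y(1) lM commute by fastforce
      then show False using BC(5) y(2) unfolding disjnt_def by blast
    qed
    then show "p \<in> M" using lM by simp
  qed
  ultimately have "M = (\<Inter>n. \<Union>(W n))" by (rule equalityI)
  also have "gdelta_in K \<dots>"
    using opn by (intro gdelta_in_Inter) (auto intro: open_imp_gdelta_in)
  finally show ?thesis .
qed

lemma completely_metrizable_dense_imp_gdelta_in:
  assumes "Hausdorff_space K" "K closure_of S = topspace K" "S \<subseteq> topspace K"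
    and "completely_metrizable_space (subtopology K S)"
  shows "gdelta_in K S"
proof -
  obtain T d where Td: "Metric_space T d" "Metric_space.mcomplete T d"
      "subtopology K S = Metric_space.mtopology T d"
    using assms(4) unfolding completely_metrizable_space_def by blast
  have "T = S"
    using Td(1,3) assms(3) Metric_space.topspace_mtopology topspace_subtopology_subset by metis
  then show ?thesis
    using Metric_space.dense_mcomplete_imp_gdelta_in assms(1-3) Td by metis
qed

section \<open>From complete metrizability to Cech-completeness and the Baire property\<close>

lemma completely_metrizable_imp_cech_complete_space:
  assumes "completely_metrizable_space X"
  shows "cech_complete_space X"
proof -
  let ?S = "stone_cech_map X ` topspace X"
  have tych: "tychonoff_space X"
    using assms completely_metrizable_imp_metrizable_space metrizable_imp_Hausdorff_space
      metrizable_imp_completely_regular_space unfolding tychonoff_space_def by blast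
  \<comment> \<open>The image of \<open>X\<close> in its compactification is homeomorphic to
    \<open>X\<close> and so inherits complete metrizability; it is also dense, so the
    \<open>G_\<delta>\<close> criterion applies.\<close>
  have "homeomorphic_map X (subtopology (stone_cech X) ?S) (stone_cech_map X)"
    using embedding_stone_cech_map[OF tych] unfolding embedding_map_def .
  then have "completely_metrizable_space (subtopology (stone_cech X) ?S)"
    using assms homeomorphic_completely_metrizable_space homeomorphic_map_imp_homeomorphic_space by blast
  moreover have "?S \<subseteq> topspace (stone_cech X)"
    unfolding stone_cech_def topspace_subtopology
    using stone_cech_map_in_cube closure_of_subset[OF stone_cech_map_in_cube] by (rule Int_greatest)
  ultimately have "gdelta_in (stone_cech X) ?S"
    using completely_metrizable_dense_imp_gdelta_in compact_Hausdorff_stone_cech(2)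
      dense_stone_cech_map by blast
  then show ?thesis using tych unfolding cech_complete_space_def by blast
qed

lemma completely_metrizable_imp_baire_space:
  assumes "completely_metrizable_space X"
  shows "baire_space X"
proof -
  obtain T d where Td: "Metric_space T d" "Metric_space.mcomplete T d"
      "X = Metric_space.mtopology T d"
    using assms unfolding completely_metrizable_space_def by blast
  show ?thesis
    unfolding baire_space_def
  proof (intro allI impI)
    fix U :: "nat \<Rightarrow> 'a set"
    assume U: "\<forall>n. openin X (U n) \<and> X closure_of (U n) = topspace X"
    have top: "topspace X = T" using Td by (simp add: Metric_space.topspace_mtopology)
    show "X closure_of (\<Inter>n. U n) = topspace X"
      unfolding top unfolding Td(3)
      by (rule Metric_space.metric_Baire_category[OF Td(1,2)])
         (use U top Td(3) in auto)
  qed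
qed


section \<open>The truncated \<open>L\<^sup>1\<close> distance\<close>

text \<open>Truncation at 1 makes the integrand bounded, so that on a finite measure space any two
  measurable functions have a finite distance.\<close>

definition trunc_dist :: "'a measure \<Rightarrow> ('a \<Rightarrow> real) \<Rightarrow> ('a \<Rightarrow> real) \<Rightarrow> real" where
  "trunc_dist M f g = (\<integral>x. min 1 \<bar>f x - g x\<bar> \<partial>M)"

lemma trunc_dist_nonneg: "0 \<le> trunc_dist M f g"
  unfolding trunc_dist_def by (rule integral_nonneg_AE) auto

lemma trunc_dist_commute: "trunc_dist M f g = trunc_dist M g f"
  unfolding trunc_dist_def by (simp add: abs_minus_commute)

context finite_measure
begin

section \<open>Pseudometric properties of the truncated distance\<close>

lemma integrable_trunc:
  assumes [measurable]: "f \<in> borel_measurable M" "g \<in> borel_measurable M"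
  shows "integrable M (\<lambda>x. min 1 \<bar>f x - g x :: real\<bar>)"
  by (rule integrable_const_bound[where B = 1]) auto

lemma trunc_dist_eq_0_iff:
  assumes "f \<in> borel_measurable M" "g \<in> borel_measurable M"
  shows "trunc_dist M f g = 0 \<longleftrightarrow> (AE x in M. f x = g x)"
proof -
  have "trunc_dist M f g = 0 \<longleftrightarrow> (AE x in M. min 1 \<bar>f x - g x\<bar> = 0)"
    unfolding trunc_dist_def
    by (rule integral_nonneg_eq_0_iff_AE[OF integrable_trunc[OF assms]]) simp
  also have "\<dots> \<longleftrightarrow> (AE x in M. f x = g x)"
    by (rule AE_cong) (auto simp: min_def)
  finally show ?thesis .
qed

lemma trunc_dist_triangle:
  assumes "f \<in> borel_measurable M" "g \<in> borel_measurable M" "h \<in> borel_measurable M"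
  shows "trunc_dist M f h \<le> trunc_dist M f g + trunc_dist M g h"
proof -
  \<comment> \<open>The map \<open>t \<mapsto> min 1 t\<close> is monotone and subadditive on
    nonnegative reals, so the inequality already holds pointwise.\<close>
  have "trunc_dist M f h \<le> (\<integral>x. min 1 \<bar>f x - g x\<bar> + min 1 \<bar>g x - h x\<bar> \<partial>M)"
    unfolding trunc_dist_def
    by (intro integral_mono integrable_trunc Bochner_Integration.integrable_add assms) auto
  also have "\<dots> = trunc_dist M f g + trunc_dist M g h"
    unfolding trunc_dist_def by (intro Bochner_Integration.integral_add integrable_trunc assms)
  finally show ?thesis .
qed

text \<open>Markov's inequality bounds the measure of a deviation set by a multiple of the distance.
  Conversely, splitting the integral at level \<open>c\<close> bounds the distance by
  \<open>c\<close> times the total measure plus the measure of the deviation set.\<close>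

lemma fun_converges_in_measure_iff_trunc_dist:
  assumes f[measurable]: "\<And>n. f n \<in> borel_measurable M" and g[measurable]: "g \<in> borel_measurable M"
  shows "fun_converges_in_measure M f g \<longleftrightarrow> (\<lambda>n. trunc_dist M (f n) g) \<longlonglongrightarrow> 0"
proof -
  have "(\<lambda>n. ennreal (measure M {x \<in> space M. \<bar>f n x - g x\<bar> > c})) \<longlonglongrightarrow> 0 \<longleftrightarrow>
      (\<lambda>n. measure M {x \<in> space M. \<bar>f n x - g x\<bar> > c}) \<longlonglongrightarrow> 0" for c
    by (rule ennreal_tendsto_0_iff) (rule measure_nonneg)
  then have "fun_converges_in_measure M f g \<longleftrightarrow>
      (\<forall>c>0. (\<lambda>n. measure M {x \<in> space M. \<bar>f n x - g x\<bar> > c}) \<longlonglongrightarrow> 0)"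
    unfolding fun_converges_in_measure_def emeasure_eq_measure by simp
  also have "\<dots> \<longleftrightarrow> (\<lambda>n. trunc_dist M (f n) g) \<longlonglongrightarrow> 0"
  proof (intro iffI allI impI)
    fix c :: real assume lim: "(\<lambda>n. trunc_dist M (f n) g) \<longlonglongrightarrow> 0" and c: "c > 0"
    \<comment> \<open>The truncated integrand never exceeds 1, so the level in Markov's inequality
      is capped at 1 as well.\<close>
    define c' where "c' = min 1 c"
    have c': "c' > 0" unfolding c'_def using c by simp
    have "measure M {x \<in> space M. \<bar>f n x - g x\<bar> > c} \<le> trunc_dist M (f n) g / c'" for n
    proof -
      have "measure M {x \<in> space M. \<bar>f n x - g x\<bar> > c}
          \<le> measure M {x \<in> space M. min 1 \<bar>f n x - g x\<bar> \<ge> c'}"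
        by (rule finite_measure_mono) (auto simp: c'_def)
      also have "\<dots> \<le> trunc_dist M (f n) g / c'"
        unfolding trunc_dist_def
        by (rule integral_Markov_inequality_measure[OF integrable_trunc[OF f g] sets.top _ c']) auto
      finally show ?thesis .
    qed
    then have "\<forall>\<^sub>F n in sequentially.
        norm (measure M {x \<in> space M. \<bar>f n x - g x\<bar> > c}) \<le> trunc_dist M (f n) g / c'"
      by simp
    moreover have "(\<lambda>n. trunc_dist M (f n) g / c') \<longlonglongrightarrow> 0"
      using tendsto_divide[OF lim tendsto_const[of c']] c' by simp
    ultimately show "(\<lambda>n. measure M {x \<in> space M. \<bar>f n x - g x\<bar> > c}) \<longlonglongrightarrow> 0"
      by (rule Lim_null_comparison)
  next
    assume conv: "\<forall>c>0. (\<lambda>n. measure M {x \<in> space M. \<bar>f n x - g x\<bar> > c}) \<longlonglongrightarrow> 0"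
    have bound: "trunc_dist M (f n) g
        \<le> c * measure M (space M) + measure M {x \<in> space M. \<bar>f n x - g x\<bar> > c}"
      if c: "c > 0" for c :: real and n
    proof -
      let ?A = "{x \<in> space M. \<bar>f n x - g x\<bar> > c}"
      have A: "?A \<in> sets M" by measurable
      have int: "integrable M (indicator ?A :: 'a \<Rightarrow> real)"
        by (rule integrable_real_indicator[OF A]) (simp add: less_top[symmetric])
      \<comment> \<open>Off \<open>?A\<close> the integrand is at most \<open>c\<close>; on
        \<open>?A\<close> the truncation bounds it by 1.\<close>
      have "trunc_dist M (f n) g \<le> (\<integral>x. c + indicator ?A x \<partial>M)"
        unfolding trunc_dist_def
      proof (rule integral_mono[OF integrable_trunc[OF f g]])
        show "integrable M (\<lambda>x. c + indicator ?A x)" using int by simp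
      qed (use c in \<open>auto simp: indicator_def\<close>)
      also have "\<dots> = c * measure M (space M) + measure M ?A"
        using A int by (subst Bochner_Integration.integral_add) (auto simp: mult.commute)
      finally show ?thesis .
    qed
    show "(\<lambda>n. trunc_dist M (f n) g) \<longlonglongrightarrow> 0"
    proof (rule LIMSEQ_I)
      fix e :: real assume e: "e > 0"
      \<comment> \<open>Adding 1 keeps the divisor positive and makes
        \<open>c * measure M (space M)\<close> strictly less than \<open>e / 2\<close>.\<close>
      define m where "m = measure M (space M) + 1"
      have m: "m > 0" "measure M (space M) < m" unfolding m_def by (simp_all add: add_nonneg_pos)
      define c where "c = e / (2 * m)"
      have c: "c > 0" "c * measure M (space M) < e / 2"
        unfolding c_def using e m by (auto simp: field_simps)
      obtain N where N: "\<And>n. n \<ge> N \<Longrightarrow> measure M {x \<in> space M. \<bar>f n x - g x\<bar> > c} < e / 2"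
        using LIMSEQ_D[OF conv[rule_format, OF c(1)], of "e / 2"] e by auto
      have "norm (trunc_dist M (f n) g - 0) < e" if "n \<ge> N" for n
        using bound[OF c(1), of n] c(2) N[OF that] trunc_dist_nonneg[of M "f n" g] by simp
      then show "\<exists>N. \<forall>n\<ge>N. norm (trunc_dist M (f n) g - 0) < e" by blast
    qed
  qed
  finally show ?thesis .
qed

text \<open>The truncated increments have summable integrals, so by monotone convergence their sum
  is finite almost everywhere. The functions therefore converge almost everywhere, and dominated
  convergence turns this into convergence in distance.\<close>

lemma trunc_dist_fast_Cauchy_convergent:
  assumes f[measurable]: "\<And>n. f n \<in> borel_measurable M"
    and fast: "\<And>n. trunc_dist M (f n) (f (Suc n)) \<le> (1/2) ^ n"
  shows "\<exists>g\<in>borel_measurable M. (\<lambda>n. trunc_dist M (f n) g) \<longlonglongrightarrow> 0"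
proof -
  define h where "h n x = min 1 \<bar>f n x - f (Suc n) x\<bar>" for n x
  have [measurable]: "h n \<in> borel_measurable M" for n unfolding h_def by measurable
  have "(\<integral>\<^sup>+x. (\<Sum>n. ennreal (h n x)) \<partial>M) = (\<Sum>n. \<integral>\<^sup>+x. ennreal (h n x) \<partial>M)"
    by (rule nn_integral_suminf) measurable
  also have "\<dots> = (\<Sum>n. ennreal (trunc_dist M (f n) (f (Suc n))))"
    unfolding trunc_dist_def h_def
    by (intro suminf_cong nn_integral_eq_integral integrable_trunc f) auto
  also have "\<dots> \<le> (\<Sum>n. ennreal ((1/2) ^ n))"
    by (intro suminf_le ennreal_leI fast) auto
  also have "\<dots> < \<infinity>"
    by (subst suminf_ennreal2) (auto simp: summable_geometric)
  finally have "AE x in M. (\<Sum>n. ennreal (h n x)) \<noteq> \<infinity>"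
    by (intro nn_integral_PInf_AE) auto
  then have AE_conv: "AE x in M. convergent (\<lambda>n. f n x)"
  proof (rule eventually_mono)
    fix x assume "(\<Sum>n. ennreal (h n x)) \<noteq> \<infinity>"
    then have sum: "summable (\<lambda>n. h n x)"
      by (intro summable_suminf_not_top) (auto simp: h_def)
    \<comment> \<open>The terms of a convergent series tend to 0, so the truncation is eventually
      inactive and the untruncated increments are summable too.\<close>
    then have "eventually (\<lambda>n. h n x < 1) sequentially"
      using summable_LIMSEQ_zero order_tendstoD(2) zero_less_one by blast
    then have "eventually (\<lambda>n. norm (f (Suc n) x - f n x) = h n x) sequentially"
      by (rule eventually_mono) (auto simp: h_def)
    then have "summable (\<lambda>n. norm (f (Suc n) x - f n x)) \<longleftrightarrow> summable (\<lambda>n. h n x)"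
      by (rule summable_cong)
    then have "summable (\<lambda>n. norm (f (Suc n) x - f n x))" using sum by blast
    then have "convergent (\<lambda>n. \<Sum>i<n. f (Suc i) x - f i x)"
      using summable_norm_cancel summable_iff_convergent by blast
    then have "convergent (\<lambda>n. f n x - f 0 x)"
      unfolding sum_lessThan_telescope[of "\<lambda>i. f i x"] .
    then have "convergent (\<lambda>n. (f n x - f 0 x) + f 0 x)"
      by (rule convergent_add[OF _ convergent_const])
    then show "convergent (\<lambda>n. f n x)" by simp
  qed
  \<comment> \<open>Where the sequence diverges, \<open>lim\<close> returns an unspecified constant;
    this affects only a null set and leaves \<open>g\<close> measurable.\<close>
  define g where "g x = lim (\<lambda>n. f n x)" for x
  have g[measurable]: "g \<in> borel_measurable M" unfolding g_def by measurable
  have "(\<lambda>n. trunc_dist M (f n) g) \<longlonglongrightarrow> (\<integral>x. 0 \<partial>M)"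
    unfolding trunc_dist_def
  proof (rule integral_dominated_convergence[where w = "\<lambda>_. 1"])
    show "AE x in M. (\<lambda>n. min 1 \<bar>f n x - g x\<bar>) \<longlonglongrightarrow> 0"
      using AE_conv
    proof (rule eventually_mono)
      fix x assume "convergent (\<lambda>n. f n x)"
      then have "(\<lambda>n. f n x) \<longlonglongrightarrow> g x" unfolding g_def convergent_LIMSEQ_iff .
      then have "(\<lambda>n. min 1 \<bar>f n x - g x\<bar>) \<longlonglongrightarrow> min 1 \<bar>g x - g x\<bar>"
        by (intro tendsto_intros)
      then show "(\<lambda>n. min 1 \<bar>f n x - g x\<bar>) \<longlonglongrightarrow> 0" by simp
    qed
  qed auto
  then show ?thesis using g by auto
qed

end


section \<open>The metric of convergence in measure\<close>

definition class_rep :: "('a \<Rightarrow> real) set \<Rightarrow> 'a \<Rightarrow> real" where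
  "class_rep F = (SOME f. f \<in> F)"

text \<open>On \<open>ae_classes M\<close> the chosen representatives do not influence the value,
  since almost everywhere equal functions give equal integrals.\<close>

definition class_dist :: "'a measure \<Rightarrow> ('a \<Rightarrow> real) set \<Rightarrow> ('a \<Rightarrow> real) set \<Rightarrow> real" where
  "class_dist M F G = trunc_dist M (class_rep F) (class_rep G)"

lemma class_rep_in: "F \<in> ae_classes M \<Longrightarrow> class_rep F \<in> F"
  unfolding class_rep_def using ae_classes_rep(1) by (rule someI_ex)

lemma borel_measurable_class_rep: "F \<in> ae_classes M \<Longrightarrow> class_rep F \<in> borel_measurable M"
  using ae_classes_rep(2) class_rep_in by blast

lemma ae_classes_eqI:
  assumes "F \<in> ae_classes M" "G \<in> ae_classes M" "f \<in> F" "g \<in> G" "AE x in M. f x = g x"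
  shows "F = G"
  using assms ae_classes_rep(2) quotient_eqI[OF equiv_ae_eq_rel, of F M G f g]
  unfolding ae_classes_def ae_eq_rel_def by blast

context finite_measure
begin

lemma Metric_space_class_dist: "Metric_space (ae_classes M) (class_dist M)"
proof
  show "0 \<le> class_dist M F G" for F G
    unfolding class_dist_def by (rule trunc_dist_nonneg)
  show "class_dist M F G = class_dist M G F" for F G
    unfolding class_dist_def by (rule trunc_dist_commute)
  \<comment> \<open>Distance zero means that the representatives agree almost everywhere, which is
    the identification made by the quotient.\<close>
  show "class_dist M F G = 0 \<longleftrightarrow> F = G" if "F \<in> ae_classes M" "G \<in> ae_classes M" for F G
    unfolding class_dist_def
    using trunc_dist_eq_0_iff[OF that[THEN borel_measurable_class_rep]]
      ae_classes_eqI[OF that that[THEN class_rep_in]] by auto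
  show "class_dist M F H \<le> class_dist M F G + class_dist M G H"
    if "F \<in> ae_classes M" "G \<in> ae_classes M" "H \<in> ae_classes M" for F G H
    unfolding class_dist_def
    by (rule trunc_dist_triangle[OF that[THEN borel_measurable_class_rep]])
qed

sublocale measure_metric: Metric_space "ae_classes M" "class_dist M"
  by (rule Metric_space_class_dist)

lemma limitin_measure_metric_iff:
  assumes F: "\<And>n. F n \<in> ae_classes M" and G: "G \<in> ae_classes M"
  shows "limitin measure_metric.mtopology F G sequentially \<longleftrightarrow>
    (\<lambda>n. class_dist M (F n) G) \<longlonglongrightarrow> 0"
  using assms unfolding measure_metric.limit_metric_sequentially LIMSEQ_iff by simp

lemma converges_in_measure_iff_limitin:
  assumes F: "\<And>n. F n \<in> ae_classes M" and G: "G \<in> ae_classes M"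
  shows "converges_in_measure M F G \<longleftrightarrow> limitin measure_metric.mtopology F G sequentially"
proof -
  let ?conv = "fun_converges_in_measure M (\<lambda>n. class_rep (F n)) (class_rep G)"
  have "converges_in_measure M F G \<longleftrightarrow> ?conv"
  proof
    assume "converges_in_measure M F G"
    then show ?conv
      unfolding converges_in_measure_iff_all_reps[OF F G]
      using class_rep_in[OF F] class_rep_in[OF G] by simp
  next
    assume ?conv
    then show "converges_in_measure M F G"
      unfolding converges_in_measure_def using class_rep_in[OF F] class_rep_in[OF G]
      by (intro exI[of _ "\<lambda>n. class_rep (F n)"] exI[of _ "class_rep G"]) simp
  qed
  then show ?thesis
    unfolding limitin_measure_metric_iff[OF F G] class_dist_def
    using fun_converges_in_measure_iff_trunc_dist[OF borel_measurable_class_rep[OF F]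
        borel_measurable_class_rep[OF G]] by simp
qed

section \<open>Identification of the topology, and completeness of the metric\<close>

lemma measure_topology_eq_mtopology: "measure_topology M = measure_metric.mtopology"
proof -
  \<comment> \<open>In a metric space, closed means sequentially closed. Since the convergent
    sequences are the same, this is the condition of being fixed by
    \<open>measure_closure\<close>.\<close>
  have closed: "closedin measure_metric.mtopology A \<longleftrightarrow> A \<subseteq> ae_classes M \<and> A = measure_closure M A"
    for A
  proof (cases "A \<subseteq> ae_classes M")
    case True
    have "converges_in_measure M F G \<longleftrightarrow> limitin measure_metric.mtopology F G sequentially"
      if "G \<in> ae_classes M" "\<forall>n. F n \<in> A" for F G
      using that True by (intro converges_in_measure_iff_limitin) auto
    then have "G \<in> measure_closure M A \<longleftrightarrow>
        (\<exists>F. range F \<subseteq> A \<and> limitin measure_metric.mtopology F G sequentially)" for G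
      unfolding measure_closure_def image_subset_iff
      by (cases "G \<in> ae_classes M") (auto dest: measure_metric.limitin_mspace)
    then have "closedin measure_metric.mtopology A \<longleftrightarrow> measure_closure M A \<subseteq> A"
      unfolding measure_metric.metric_closedin_iff_sequentially_closed using True by blast
    then show ?thesis
      using True measure_closure_superset[OF True] by blast
  qed (simp add: measure_metric.metric_closedin_iff_sequentially_closed)
  show ?thesis
    unfolding topology_eq
  proof
    fix U
    have "openin measure_metric.mtopology U \<longleftrightarrow>
        U \<subseteq> ae_classes M \<and> closedin measure_metric.mtopology (ae_classes M - U)"
      unfolding openin_closedin_eq measure_metric.topspace_mtopology ..
    \<comment> \<open>Complementation is an involution on subsets of \<open>ae_classes M\<close>, so
      \<open>A\<close> can be taken to be the complement of \<open>U\<close>.\<close>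
    also have "\<dots> \<longleftrightarrow>
        (\<exists>A. closedin measure_metric.mtopology A \<and> U = ae_classes M - A)"
      using measure_metric.metric_closedin_iff_sequentially_closed double_diff[OF _ order_refl]
      by (metis Diff_subset)
    finally show "openin (measure_topology M) U = openin measure_metric.mtopology U"
      unfolding openin_measure_topology closed conj_assoc ..
  qed
qed

text \<open>A Cauchy sequence converges as soon as one subsequence does, so it suffices to extract a
  subsequence with geometrically decreasing distances.\<close>

lemma mcomplete_measure_metric: "measure_metric.mcomplete"
  unfolding measure_metric.mcomplete_def
proof (intro allI impI)
  fix F assume cauchy: "measure_metric.MCauchy F"
  have F: "F n \<in> ae_classes M" for n
    using cauchy unfolding measure_metric.MCauchy_def by blast
  have "\<forall>k. \<exists>N. \<forall>n n'. N \<le> n \<longrightarrow> N \<le> n' \<longrightarrow> class_dist M (F n) (F n') < (1/2) ^ k"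
    using cauchy unfolding measure_metric.MCauchy_def by simp
  then obtain N where
    N: "\<And>k n n'. N k \<le> n \<Longrightarrow> N k \<le> n' \<Longrightarrow> class_dist M (F n) (F n') < (1/2) ^ k"
    by metis
  \<comment> \<open>The sum dominates each single \<open>N k\<close>, and the summand
    \<open>k\<close> makes \<open>r\<close> strictly increasing even if some \<open>N i\<close>
    vanish.\<close>
  define r where "r k = (\<Sum>i\<le>k. N i) + k" for k
  have mono: "strict_mono r" unfolding strict_mono_Suc_iff r_def by simp
  have "N k \<le> r k" for k
    unfolding r_def using member_le_sum[of k "{..k}" N] by simp
  moreover have "r k \<le> r (Suc k)" for k using mono by (simp add: strict_mono_Suc_iff less_imp_le)
  ultimately have fast: "class_dist M (F (r k)) (F (r (Suc k))) < (1/2) ^ k" for k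
    using N order_trans by blast
  obtain g where g: "g \<in> borel_measurable M"
      "(\<lambda>n. trunc_dist M (class_rep (F (r n))) g) \<longlonglongrightarrow> 0"
    using trunc_dist_fast_Cauchy_convergent[of "\<lambda>n. class_rep (F (r n))"]
      borel_measurable_class_rep[OF F] fast unfolding class_dist_def by (meson less_imp_le)
  \<comment> \<open>The limit function \<open>g\<close> is turned back into a point of the space by
    taking its class.\<close>
  define G where "G = ae_eq_rel M `` {g}"
  have G: "G \<in> ae_classes M" "g \<in> G"
    unfolding G_def ae_classes_def
    using g(1) equiv_class_self[OF equiv_ae_eq_rel] by (auto intro: quotientI)
  have "fun_converges_in_measure M (\<lambda>n. class_rep (F (r n))) g"
    using fun_converges_in_measure_iff_trunc_dist[OF borel_measurable_class_rep[OF F] g(1)] g(2) by simp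
  then have "converges_in_measure M (F \<circ> r) G"
    unfolding converges_in_measure_def using class_rep_in[OF F] G(2)
    by (intro exI[of _ "\<lambda>n. class_rep (F (r n))"] exI[of _ g]) simp
  then have "limitin measure_metric.mtopology (F \<circ> r) G sequentially"
    using converges_in_measure_iff_limitin[of "F \<circ> r" G] F G(1) by simp
  then show "\<exists>G. limitin measure_metric.mtopology F G sequentially"
    using measure_metric.MCauchy_convergent_subsequence[OF cauchy mono] by blast
qed

lemma completely_metrizable_measure_topology: "completely_metrizable_space (measure_topology M)"
  unfolding measure_topology_eq_mtopology
  by (rule measure_metric.completely_metrizable_space_mtopology[OF mcomplete_measure_metric])

end

theorem corollary2p17:
  fixes M :: "'a measure"
  assumes "prob_space M"
  shows "cech_complete_space (measure_topology M) \<and> baire_space (measure_topology M)"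
proof -
  interpret prob_space M by fact
  show ?thesis
    using completely_metrizable_measure_topology completely_metrizable_imp_cech_complete_space
      completely_metrizable_imp_baire_space by blast
qed

end
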